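(* Let $n$ be a positive integer. Then the Sylow subgroups of $\mathrm{Sym}_n$ are IYB groups.
   Context: $\mathrm{Sym}_n$ is the symmetric group of degree $n$. $\mathrm{Fa}_m$ is the free abelian group (written multiplicatively) with basis $u_1,\dots,u_m$, and $\mathrm{Fa}_m\rtimes \mathrm{Sym}_m$ is the semidirect product for the natural action $\sigma(u_i)=u_{\sigma(i)}$. A finite group $G$ is an involutive Yang-Baxter (IYB) group if for some positive integer $m$ there is a map $\phi:\mathrm{Fa}_m\to \mathrm{Sym}_m$ such that $\{(a,\phi(a)) : a\in \mathrm{Fa}_m\}$ is a subgroup of $\mathrm{Fa}_m\rtimes \mathrm{Sym}_m$ and $G\cong\phi(\mathrm{Fa}_m)$. *)

theory Defs
  imports "HOL-Algebra.Sylow" "HOL-Algebra.Sym_Groups" "HOL-Algebra.Free_Abelian_Groups"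
begin

definition sylow_subgroup :: "nat \<Rightarrow> 'a set \<Rightarrow> ('a, 'b) monoid_scheme \<Rightarrow> bool"
  where "sylow_subgroup p P G \<longleftrightarrow>
    prime p \<and> finite (carrier G) \<and> subgroup P G \<and> card P = p ^ multiplicity p (order G)"

definition semidirect_product ::
  "('a, 'c) monoid_scheme \<Rightarrow> ('b, 'd) monoid_scheme \<Rightarrow> ('b \<Rightarrow> 'a \<Rightarrow> 'a) \<Rightarrow> ('a \<times> 'b) monoid"
  where "semidirect_product N H \<theta> =
    \<lparr>carrier = carrier N \<times> carrier H,
     monoid.mult = (\<lambda>(a, s) (b, t). (a \<otimes>\<^bsub>N\<^esub> \<theta> s b, s \<otimes>\<^bsub>H\<^esub> t)),
     one = (\<one>\<^bsub>N\<^esub>, \<one>\<^bsub>H\<^esub>)\<rparr>"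

text \<open>The group operation of \<^const>\<open>free_Abelian_group\<close> is the addition of finitely supported
  integer-valued functions; the basis element \<open>u\<^sub>i\<close> is \<open>frag_of i\<close>.\<close>

abbreviation Fa :: "nat \<Rightarrow> (nat \<Rightarrow>\<^sub>0 int) monoid"
  where "Fa m \<equiv> free_Abelian_group {1..m}"

definition perm_action :: "('a \<Rightarrow> 'a) \<Rightarrow> ('a \<Rightarrow>\<^sub>0 int) \<Rightarrow> ('a \<Rightarrow>\<^sub>0 int)"
  where "perm_action \<sigma> = frag_extend (\<lambda>i. frag_of (\<sigma> i))"

lemma perm_action_frag_of [simp]: "perm_action \<sigma> (frag_of i) = frag_of (\<sigma> i)"
  by (simp add: perm_action_def)

definition Fa_Sym :: "nat \<Rightarrow> ((nat \<Rightarrow>\<^sub>0 int) \<times> (nat \<Rightarrow> nat)) monoid"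
  where "Fa_Sym m = semidirect_product (Fa m) (sym_group m) perm_action"

definition IYB_group :: "('a, 'b) monoid_scheme \<Rightarrow> bool"
  where "IYB_group G \<longleftrightarrow> group G \<and> finite (carrier G) \<and>
    (\<exists>m>0. \<exists>\<phi> \<in> carrier (Fa m) \<rightarrow> carrier (sym_group m).
       subgroup {(a, \<phi> a) |a. a \<in> carrier (Fa m)} (Fa_Sym m) \<and>
       G \<cong> (sym_group m)\<lparr>carrier := \<phi> ` carrier (Fa m)\<rparr>)"

lemma perm_action_add: "perm_action \<sigma> (a + b) = perm_action \<sigma> a + perm_action \<sigma> b"
  by (simp add: perm_action_def frag_extend_add)

lemma perm_action_comp: "perm_action (\<sigma> \<circ> \<tau>) a = perm_action \<sigma> (perm_action \<tau> a)"
  unfolding perm_action_def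
  using subset_UNIV by (induction a rule: frag_induction) (simp_all add: frag_extend_diff)

lemma perm_action_id [simp]: "perm_action id a = a"
  unfolding perm_action_def
  using subset_UNIV by (induction a rule: frag_induction) (simp_all add: frag_extend_diff)

lemma perm_action_closed:
  assumes "\<sigma> permutes S" "a \<in> carrier (free_Abelian_group S)"
  shows "perm_action \<sigma> a \<in> carrier (free_Abelian_group S)"
  using assms keys_frag_extend[of "\<lambda>i. frag_of (\<sigma> i)" a] permutes_in_image[OF assms(1)]
  unfolding perm_action_def free_Abelian_group_def by (fastforce split: if_splits)

lemma group_Fa_Sym: "group (Fa_Sym m)"
proof (rule groupI)
  note defs = Fa_Sym_def semidirect_product_def
  interpret F: group "Fa m" by simp
  interpret S: group "sym_group m" by (rule sym_group_is_group)
  have mult: "monoid.mult (Fa m) = (+)" "one (Fa m) = 0"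
    by (simp_all add: free_Abelian_group_def)
  note smult = sym_group_mult sym_group_one
  have closed: "perm_action s a \<in> carrier (Fa m)"
    if "s \<in> carrier (sym_group m)" "a \<in> carrier (Fa m)" for s a
    using that perm_action_closed by (metis sym_group_carrier)
  show "x \<otimes>\<^bsub>Fa_Sym m\<^esub> y \<in> carrier (Fa_Sym m)"
    if "x \<in> carrier (Fa_Sym m)" "y \<in> carrier (Fa_Sym m)" for x y
    using that closed F.m_closed S.m_closed by (auto simp: defs simp del: carrier_free_Abelian_group_iff)
  show "\<one>\<^bsub>Fa_Sym m\<^esub> \<in> carrier (Fa_Sym m)"
    using F.one_closed S.one_closed by (simp add: defs)
  show "x \<otimes>\<^bsub>Fa_Sym m\<^esub> y \<otimes>\<^bsub>Fa_Sym m\<^esub> z = x \<otimes>\<^bsub>Fa_Sym m\<^esub> (y \<otimes>\<^bsub>Fa_Sym m\<^esub> z)" for x y z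
    by (cases x; cases y; cases z)
       (simp add: defs mult smult perm_action_add perm_action_comp comp_assoc add.assoc)
  show "\<one>\<^bsub>Fa_Sym m\<^esub> \<otimes>\<^bsub>Fa_Sym m\<^esub> x = x" for x
    by (cases x) (simp add: defs mult smult)
  show "\<exists>y\<in>carrier (Fa_Sym m). y \<otimes>\<^bsub>Fa_Sym m\<^esub> x = \<one>\<^bsub>Fa_Sym m\<^esub>"
    if "x \<in> carrier (Fa_Sym m)" for x
  proof -
    have "x \<in> carrier (Fa m) \<times> carrier (sym_group m)"
      using that by (simp add: defs)
    then obtain a s where x: "x = (a, s)" "a \<in> carrier (Fa m)" "s \<in> carrier (sym_group m)"
      by blast
    define t where "t = inv\<^bsub>sym_group m\<^esub> s"
    have t: "t \<in> carrier (sym_group m)"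
      and ts: "t \<otimes>\<^bsub>sym_group m\<^esub> s = \<one>\<^bsub>sym_group m\<^esub>"
      unfolding t_def using x(3) by (simp_all only: S.inv_closed S.l_inv)
    define b where "b = inv\<^bsub>Fa m\<^esub> (perm_action t a)"
    have b: "b \<in> carrier (Fa m)"
      and ba: "b \<otimes>\<^bsub>Fa m\<^esub> perm_action t a = \<one>\<^bsub>Fa m\<^esub>"
      unfolding b_def using closed[OF t x(2)] by (simp_all only: F.inv_closed F.l_inv)
    have "(b, t) \<in> carrier (Fa_Sym m)" "(b, t) \<otimes>\<^bsub>Fa_Sym m\<^esub> x = \<one>\<^bsub>Fa_Sym m\<^esub>"
      using b t ba ts by (simp_all add: defs x(1))
    then show ?thesis by blast
  qed
qed

end

theory Submission
  imports Defs "HOL-Algebra.Group_Action"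
begin

text \<open>
  An IYB structure on a finite group \<open>G\<close> comes from a faithful action of \<open>G\<close> on a finite set
  \<open>X\<close> together with a surjection \<open>\<Phi>\<close> from the integer-valued functions on \<open>X\<close> onto \<open>G\<close>
  satisfying the cocycle law \<open>\<Phi> (a + \<Phi> a \<cdot> b) = \<Phi> a \<circ> \<Phi> b\<close>: this law says exactly that the graph
  of \<open>\<Phi>\<close> is closed under multiplication in the semidirect product
  (\<open>IYB_group_if_iso_image_group\<close>). So it suffices to find such a cocycle for one
  Sylow \<open>p\<close>-subgroup of the symmetric group on \<open>n\<close> points, because all of them are isomorphic
  (\<open>iso_sylow_subgroup_if_embedded\<close>).

  The set \<open>X\<close> consists of the \<^emph>\<open>blocks\<close>: for every \<open>k\<close>, cut the \<open>n\<close> points into consecutive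
  intervals of length \<open>p ^ k\<close> and discard the incomplete last one. Ordered by inclusion the blocks
  form a forest; its leaves are the points, and every other block has \<open>p\<close> children, which are
  ordered cyclically. Given an integer \<open>c x\<close> for each block \<open>x\<close>, let \<open>twist c\<close> be the automorphism
  of the forest that fixes the roots and, working downwards, carries the children of a block \<open>z\<close>
  to the children of its image \<open>w\<close> with a cyclic shift by \<open>c w\<close>. Twisting by \<open>b\<close> and
  then by \<open>a\<close> shifts the children of \<open>z\<close> by \<open>b\<close> at the first image of \<open>z\<close> plus \<open>a\<close> at the
  second one. That first image is \<open>twist a\<close> pulled back from the second, which is the cocycle law
  (\<open>twist_cocycle\<close>). Indexing the shift by the image \<open>w\<close> and not by \<open>z\<close> is what makes the
  law come out in this form.

  A twist depends only on the residues of \<open>c\<close> modulo \<open>p\<close> at the blocks of level \<open>k > 0\<close> and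
  determines them, so there are \<open>p ^ N\<close> twists, where \<open>N\<close> is the number of these blocks. There are
  \<open>n div p ^ k\<close> of them at level \<open>k\<close>, so by Legendre's formula \<open>N\<close> is the exponent of \<open>p\<close> in
  \<open>fact n\<close> (\<open>legendre_block_count\<close>). Since a twist is also determined by what it does to
  the points, the twists form a Sylow \<open>p\<close>-subgroup of the symmetric group.
\<close>

section \<open>Cocycles with values in permutations give IYB groups\<close>

lemma lookup_perm_action:
  assumes "inj \<sigma>"
  shows "Poly_Mapping.lookup (perm_action \<sigma> a) (\<sigma> i) = Poly_Mapping.lookup a i"
proof -
  have "Poly_Mapping.keys a \<subseteq> UNIV" by simp
  then show ?thesis
  proof (induction a rule: frag_induction)
    case (one j)
    then show ?case
      using assms by (simp add: lookup_single when_def inj_eq)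
  qed (simp_all add: perm_action_def frag_extend_diff lookup_minus)
qed

text \<open>The function \<open>b \<circ> inv (\<Phi> a)\<close> is the translate of \<open>b\<close> by \<open>\<Phi> a\<close>. The restriction to
  \<open>X\<close> of a function on the ambient type is an element of the free abelian group on \<open>X\<close>, and the
  congruence axiom says that \<open>\<Phi>\<close> is a function of this restriction.\<close>

locale permutation_cocycle =
  fixes X :: "'x set" and \<Phi> :: "('x \<Rightarrow> int) \<Rightarrow> 'x \<Rightarrow> 'x"
  assumes finite_X: "finite X"
    and X_nonempty: "X \<noteq> {}"
    and permutes: "\<Phi> c permutes X"
    and \<Phi>_cong: "(\<And>x. x \<in> X \<Longrightarrow> c x = d x) \<Longrightarrow> \<Phi> c = \<Phi> d"
    and cocycle: "\<Phi> (\<lambda>x. a x + b (inv' (\<Phi> a) x)) = \<Phi> a \<circ> \<Phi> b"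
begin

definition image_group :: "('x \<Rightarrow> 'x) monoid"
  where "image_group = \<lparr>carrier = range \<Phi>, monoid.mult = (\<circ>), one = id\<rparr>"

lemma \<Phi>_zero: "\<Phi> (\<lambda>_. 0) = id"
proof -
  have "inj (\<Phi> (\<lambda>_. 0))"
    using permutes permutes_inj by blast
  moreover have "\<Phi> (\<lambda>_. 0) \<circ> \<Phi> (\<lambda>_. 0) = \<Phi> (\<lambda>_. 0)"
    using cocycle[of "\<lambda>_. 0" "\<lambda>_. 0"] by simp
  ultimately show ?thesis
    by (simp add: fun_eq_iff inj_eq)
qed

text \<open>The argument \<open>- (a \<circ> \<Phi> a)\<close> is chosen so that its translate by \<open>\<Phi> a\<close> cancels \<open>a\<close>, which turns
  the cocycle law into \<open>\<Phi> 0 = id\<close>.\<close>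

lemma \<Phi>_comp_inverse: "\<Phi> a \<circ> \<Phi> (\<lambda>x. - a (\<Phi> a x)) = id"
  using cocycle[of a "\<lambda>x. - a (\<Phi> a x)"] permutes_inverses(1)[OF permutes]
  by (simp add: \<Phi>_zero)

lemma \<Phi>_inverse_comp: "\<Phi> (\<lambda>x. - a (\<Phi> a x)) \<circ> \<Phi> a = id"
  using \<Phi>_comp_inverse permutes_inj[OF permutes, of a]
  by (metis comp_assoc comp_id fun.inj_map_strong id_comp inj_iff permutes permutes_surj surj_iff)

lemma group_image_group: "group image_group"
proof (rule groupI)
  show "x \<otimes>\<^bsub>image_group\<^esub> y \<in> carrier image_group"
    if "x \<in> carrier image_group" "y \<in> carrier image_group" for x y
    using that cocycle[symmetric] by (auto simp: image_group_def)
  show "\<one>\<^bsub>image_group\<^esub> \<in> carrier image_group"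
    using \<Phi>_zero[symmetric] by (auto simp: image_group_def)
  show "\<exists>y\<in>carrier image_group. y \<otimes>\<^bsub>image_group\<^esub> x = \<one>\<^bsub>image_group\<^esub>"
    if "x \<in> carrier image_group" for x
    using that \<Phi>_inverse_comp by (auto simp: image_group_def)
qed (auto simp: image_group_def)

text \<open>An enumeration of \<open>X\<close> by \<open>{1..m}\<close> transports \<open>\<Phi>\<close> to the free abelian group of rank \<open>m\<close>:
  an element is read as its family of coefficients. The transported map is again a cocycle, and
  inverses in its graph exist because the translate of some \<open>b\<close> by \<open>\<phi> a\<close> is \<open>- a\<close>.\<close>

theorem IYB_group_if_iso_image_group:
  assumes "group G" and iso: "image_group \<cong> G"
  shows "IYB_group G"
proof -
  note One_nat_def [simp del]
  define m where "m = card X"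
  have "m > 0"
    using finite_X X_nonempty by (simp add: m_def card_gt_0_iff)
  obtain e where e: "bij_betw e X {1..m}"
    using finite_X m_def bij_betw_iff_card by (metis card_atLeastAtMost diff_Suc_1 finite_atLeastAtMost)
  define T where "T = map_permutation X e"
  have inj_e: "inj_on e X" and img_e: "e ` X = {1..m}"
    using e by (auto simp: bij_betw_def)
  have T_permutes: "T (\<Phi> c) permutes {1..m}" for c
    unfolding T_def by (rule map_permutation_permutes[OF e permutes])
  have T_comp: "T (f \<circ> \<Phi> c) = T f \<circ> T (\<Phi> c)" for f c
    unfolding T_def by (rule map_permutation_compose'[OF inj_e permutes])
  have T_apply: "T f (e x) = e (f x)" if "x \<in> X" for f x
    unfolding T_def by (rule map_permutation_apply[OF inj_e that])
  have T_id: "T id = id"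
    unfolding T_def by (rule map_permutation_id'[OF inj_e])
  have T_inj: "inj_on T (range \<Phi>)"
  proof (rule inj_onI)
    fix f g assume "f \<in> range \<Phi>" "g \<in> range \<Phi>" and eq: "T f = T g"
    then have fg: "f permutes X" "g permutes X"
      using permutes by auto
    show "f = g"
    proof
      fix x show "f x = g x"
      proof (cases "x \<in> X")
        case True
        then have "e (f x) = e (g x)"
          using eq T_apply by metis
        then show ?thesis
          using inj_e True fg by (metis inj_onD permutes_in_image)
      qed (use fg in \<open>simp add: permutes_not_in\<close>)
    qed
  qed

  define coeffs where "coeffs = (\<lambda>(a :: nat \<Rightarrow>\<^sub>0 int) x. Poly_Mapping.lookup a (e x))"
  define \<phi> where "\<phi> = (\<lambda>a. T (\<Phi> (coeffs a)))"
  have \<phi>_permutes: "\<phi> a permutes {1..m}" for a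
    unfolding \<phi>_def by (rule T_permutes)
  have \<phi>_mult: "\<phi> (a + perm_action (\<phi> a) b) = \<phi> a \<circ> \<phi> b" for a b
  proof -
    let ?f = "\<Phi> (coeffs a)"
    have "coeffs (a + perm_action (\<phi> a) b) x = coeffs a x + coeffs b (inv' ?f x)" if "x \<in> X" for x
    proof -
      have "inv' ?f x \<in> X"
        using that permutes_in_image[OF permutes_inv[OF permutes]] by metis
      then have "e x = \<phi> a (e (inv' ?f x))"
        unfolding \<phi>_def by (simp add: T_apply permutes_inverses(1)[OF permutes])
      then have "Poly_Mapping.lookup (perm_action (\<phi> a) b) (e x) = Poly_Mapping.lookup b (e (inv' ?f x))"
        using lookup_perm_action[OF permutes_inj[OF \<phi>_permutes]] by metis
      then show ?thesis
        by (simp add: coeffs_def lookup_add)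
    qed
    then have "\<Phi> (coeffs (a + perm_action (\<phi> a) b)) = ?f \<circ> \<Phi> (coeffs b)"
      unfolding cocycle[symmetric] by (rule \<Phi>_cong)
    then show ?thesis
      by (simp only: \<phi>_def T_comp)
  qed
  have \<phi>_0: "\<phi> 0 = id"
    by (simp add: \<phi>_def coeffs_def \<Phi>_zero T_id)

  interpret FS: group "Fa_Sym m"
    by (rule group_Fa_Sym)
  have FS_carrier: "(a, s) \<in> carrier (Fa_Sym m) \<longleftrightarrow> Poly_Mapping.keys a \<subseteq> {1..m} \<and> s permutes {1..m}"
    and FS_mult: "(a, s) \<otimes>\<^bsub>Fa_Sym m\<^esub> (b, t) = (a + perm_action s b, s \<circ> t)"
    and FS_one: "\<one>\<^bsub>Fa_Sym m\<^esub> = (0, id)" for a b s t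
    by (simp_all add: Fa_Sym_def semidirect_product_def sym_group_carrier sym_group_mult sym_group_one)
  have keys_action: "Poly_Mapping.keys (perm_action s a) \<subseteq> {1..m}"
    if "Poly_Mapping.keys a \<subseteq> {1..m}" "s permutes {1..m}" for a s
    using perm_action_closed[OF that(2), of a] that(1) by simp
  let ?graph = "{(a, \<phi> a) |a. a \<in> carrier (Fa m)}"
  have "subgroup ?graph (Fa_Sym m)"
  proof (rule FS.subgroupI)
    show "?graph \<subseteq> carrier (Fa_Sym m)"
      by (auto simp: FS_carrier \<phi>_permutes)
    show "?graph \<noteq> {}"
      by (auto intro: exI[of _ 0])
  next
    fix u v assume "u \<in> ?graph" "v \<in> ?graph"
    then obtain a b where u: "u = (a, \<phi> a)" and v: "v = (b, \<phi> b)"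
      and ab: "Poly_Mapping.keys a \<subseteq> {1..m}" "Poly_Mapping.keys b \<subseteq> {1..m}"
      by auto
    have "Poly_Mapping.keys (a + perm_action (\<phi> a) b) \<subseteq> {1..m}"
      using ab keys_action[OF ab(2) \<phi>_permutes, of a] Poly_Mapping.keys_add by fastforce
    then show "u \<otimes>\<^bsub>Fa_Sym m\<^esub> v \<in> ?graph"
      by (simp add: u v FS_mult \<phi>_mult)
  next
    fix u assume "u \<in> ?graph"
    then obtain a where u: "u = (a, \<phi> a)" and a: "Poly_Mapping.keys a \<subseteq> {1..m}"
      by auto
    \<comment> \<open>The first component of the inverse of \<open>(a, \<phi> a)\<close> in the semidirect product.\<close>
    define b where "b = - perm_action (inv' (\<phi> a)) a"
    have b: "Poly_Mapping.keys b \<subseteq> {1..m}"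
      unfolding b_def using keys_action[OF a permutes_inv[OF \<phi>_permutes]] by simp
    have "perm_action (\<phi> a) b = - perm_action (\<phi> a) (perm_action (inv' (\<phi> a)) a)"
      unfolding b_def perm_action_def by (rule frag_extend_minus)
    also have "\<dots> = - a"
      by (simp flip: perm_action_comp add: permutes_inv_o[OF \<phi>_permutes])
    finally have "a + perm_action (\<phi> a) b = 0"
      by simp
    then have "u \<otimes>\<^bsub>Fa_Sym m\<^esub> (b, \<phi> b) = \<one>\<^bsub>Fa_Sym m\<^esub>"
      using \<phi>_mult[of a b] by (simp add: u FS_mult FS_one \<phi>_0)
    moreover have "u \<in> carrier (Fa_Sym m)" "(b, \<phi> b) \<in> carrier (Fa_Sym m)"
      using a b \<phi>_permutes by (simp_all add: u FS_carrier)
    ultimately have "inv\<^bsub>Fa_Sym m\<^esub> u = (b, \<phi> b)"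
      by (metis FS.inv_equality FS.inv_inv FS.inv_closed)
    then show "inv\<^bsub>Fa_Sym m\<^esub> u \<in> ?graph"
      using b by auto
  qed
  moreover have "\<phi> \<in> carrier (Fa m) \<rightarrow> carrier (sym_group m)"
    by (simp add: sym_group_carrier \<phi>_permutes)
  moreover have "G \<cong> (sym_group m)\<lparr>carrier := \<phi> ` carrier (Fa m)\<rparr>"
  proof -
    have "T ` range \<Phi> \<subseteq> \<phi> ` carrier (Fa m)"
    proof clarify
      fix c
      \<comment> \<open>Every function on \<open>X\<close> is the coefficient family of some group element, because \<open>X\<close> is finite.\<close>
      define a where "a = (\<Sum>x\<in>X. frag_cmul (c x) (frag_of (e x)))"
      have "coeffs a x = c x" if "x \<in> X" for x
      proof -
        have "coeffs a x = (\<Sum>y\<in>X. if y = x then c y else 0)"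
          unfolding coeffs_def a_def lookup_sum
          by (rule sum.cong[OF refl])
            (use inj_e that in \<open>auto simp: lookup_single when_def inj_on_eq_iff\<close>)
        then show ?thesis
          using that finite_X by simp
      qed
      then have "\<Phi> (coeffs a) = \<Phi> c"
        by (rule \<Phi>_cong)
      moreover have "a \<in> carrier (Fa m)"
        unfolding a_def
        by (rule sum_closed_free_Abelian_group) (use img_e in \<open>auto\<close>)
      ultimately show "T (\<Phi> c) \<in> \<phi> ` carrier (Fa m)"
        unfolding \<phi>_def by (metis (no_types, lifting) imageI)
    qed
    then have "\<phi> ` carrier (Fa m) = T ` range \<Phi>"
      by (auto simp: \<phi>_def)
    then have "T \<in> iso image_group ((sym_group m)\<lparr>carrier := \<phi> ` carrier (Fa m)\<rparr>)"
      using T_inj T_comp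
      by (auto simp: image_group_def sym_group_mult intro!: isoI homI inj_on_imp_bij_betw)
    then have "image_group \<cong> (sym_group m)\<lparr>carrier := \<phi> ` carrier (Fa m)\<rparr>"
      by (rule is_isoI)
    moreover have "G \<cong> image_group"
      using group.iso_sym[OF group_image_group iso] .
    ultimately show ?thesis
      by (rule iso_trans[rotated])
  qed
  moreover have "finite (carrier G)"
  proof -
    have "range \<Phi> \<subseteq> {f. f permutes X}"
      using permutes by auto
    then have "finite (carrier image_group)"
      unfolding image_group_def using finite_permutations[OF finite_X] by (simp add: finite_subset)
    then show ?thesis
      using iso unfolding is_iso_def iso_def by (auto dest: bij_betw_finite)
  qed
  ultimately show ?thesis
    unfolding IYB_group_def using \<open>group G\<close> \<open>m > 0\<close> by blast
qed

end

section \<open>Isomorphism of Sylow subgroups\<close>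

text \<open>The restriction to \<open>E\<close> is needed because the elements of \<^const>\<open>BijGroup\<close> are extensional
  functions.\<close>

lemma group_actionI:
  assumes "group G"
    and closed: "\<And>g x. g \<in> carrier G \<Longrightarrow> x \<in> E \<Longrightarrow> f g x \<in> E"
    and mult: "\<And>g h x. g \<in> carrier G \<Longrightarrow> h \<in> carrier G \<Longrightarrow> x \<in> E \<Longrightarrow>
      f (g \<otimes>\<^bsub>G\<^esub> h) x = f g (f h x)"
    and one: "\<And>x. x \<in> E \<Longrightarrow> f \<one>\<^bsub>G\<^esub> x = x"
  shows "group_action G E (\<lambda>g. restrict (f g) E)"
proof -
  interpret group G by fact
  have Bij: "restrict (f g) E \<in> Bij E" if "g \<in> carrier G" for g
  proof -
    have "bij_betw (f g) E E"
    proof (rule bij_betw_byWitness[where f' = "f (inv\<^bsub>G\<^esub> g)"])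
      show "\<forall>x\<in>E. f (inv\<^bsub>G\<^esub> g) (f g x) = x" "\<forall>x\<in>E. f g (f (inv\<^bsub>G\<^esub> g) x) = x"
        using that by (simp_all flip: mult add: one)
    qed (use that closed in auto)
    then show ?thesis
      by (simp add: Bij_def cong: bij_betw_cong)
  qed
  then have "(\<lambda>g. restrict (f g) E) \<in> hom G (BijGroup E)"
    by (intro homI) (auto simp: BijGroup_def compose_def mult closed intro!: restrict_ext)
  then show ?thesis
    by (simp add: group_action_def group_hom_def group_hom_axioms_def group_BijGroup)
qed

text \<open>Right translation of right cosets, made into a left action by the inverse.\<close>

lemma (in group) action_on_rcosets:
  assumes "subgroup P G"
  shows "group_action G (rcosets P) (\<lambda>g. \<lambda>C\<in>rcosets P. C #> inv g)"
proof (rule group_actionI)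
  have P: "P \<subseteq> carrier G"
    using assms by (rule subgroup.subset)
  have sub: "C \<subseteq> carrier G" if "C \<in> rcosets P" for C
    using that r_coset_subset_G[OF P] unfolding RCOSETS_def by blast
  show "C #> inv g \<in> rcosets P" if "g \<in> carrier G" "C \<in> rcosets P" for g C
    using that P by (auto simp: RCOSETS_def coset_mult_assoc)
  show "C #> inv (g \<otimes> h) = C #> inv h #> inv g"
    if "g \<in> carrier G" "h \<in> carrier G" "C \<in> rcosets P" for g h C
    using that by (simp add: inv_mult_group coset_mult_assoc sub)
  show "C #> inv \<one> = C" if "C \<in> rcosets P" for C
    using that by (simp add: coset_mult_one sub)
qed (rule is_group)

text \<open>Orbit lengths are powers of \<open>p\<close>, so if \<open>p\<close> does not divide \<open>card E\<close>, then not every length is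
  divisible by \<open>p\<close>, and some orbit has length \<open>1\<close>.\<close>

lemma (in group_action) p_group_fixed_point:
  assumes "prime p" and order: "order G = p ^ k" and "finite E" and "\<not> p dvd card E"
  obtains x where "x \<in> E" "\<And>g. g \<in> carrier G \<Longrightarrow> \<phi> g x = x"
proof -
  interpret partition E "orbits G E \<phi>"
    by (rule orbit_partition)
  have "card E = (\<Sum>b\<in>orbits G E \<phi>. card b)"
    using disjoint_sum[OF \<open>finite E\<close>, of "\<lambda>_. 1::nat"] by simp
  then have "\<not> (\<forall>b\<in>orbits G E \<phi>. p dvd card b)"
    using assms(4) by (metis dvd_sum)
  then obtain x where x: "x \<in> E" and "\<not> p dvd card (orbit G \<phi> x)"
    unfolding orbits_def by blast
  moreover have "card (orbit G \<phi> x) dvd p ^ k"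
    using orbit_stabilizer_theorem[OF x] order by (metis dvd_triv_left)
  ultimately have "card (orbit G \<phi> x) = 1"
    using \<open>prime p\<close> by (metis divides_primepow_nat dvd_power neq0_conv power_0)
  then obtain z where "orbit G \<phi> x = {z}"
    by (auto simp: card_1_singleton_iff)
  then have "orbit G \<phi> x = {x}"
    using orbit_refl[OF x] by simp
  then have "\<phi> g x = x" if "g \<in> carrier G" for g
    using that unfolding orbit_def by blast
  then show thesis
    using x that by blast
qed

text \<open>The number of cosets of a Sylow \<open>p\<close>-subgroup \<open>P\<close> is prime to \<open>p\<close>, so a \<open>p\<close>-subgroup \<open>Q\<close> acting on
  them fixes some coset \<open>P #> g\<close>, and fixing this coset means that \<open>g\<close> conjugates \<open>Q\<close> into \<open>P\<close>.\<close>

lemma (in group) p_subgroup_conjugate_into_sylow: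
  assumes P: "sylow_subgroup p P G" and Q: "subgroup Q G" and card_Q: "card Q = p ^ k"
  obtains g where "g \<in> carrier G" "\<And>q. q \<in> Q \<Longrightarrow> g \<otimes> q \<otimes> inv g \<in> P"
proof -
  have p: "prime p" and fin: "finite (carrier G)" and P_sub: "subgroup P G"
    and card_P: "card P = p ^ multiplicity p (order G)"
    using P by (simp_all add: sylow_subgroup_def)
  have ord: "order G > 0"
    using fin one_closed by (auto simp: order_def card_gt_0_iff)
  have lagr: "card (rcosets P) * card P = order G"
    using lagrange[OF P_sub] .
  \<comment> \<open>The exponent of \<open>p\<close> in the order of \<open>G\<close> is already used up by \<open>P\<close>.\<close>
  have ndvd: "\<not> p dvd card (rcosets P)"
  proof
    assume "p dvd card (rcosets P)"
    then have "p ^ Suc (multiplicity p (order G)) dvd order G"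
      using lagr card_P by (metis mult_dvd_mono dvd_refl power_Suc)
    then show False
      using p ord by (metis multiplicity_dvd_iff_dvd power_dvd_iff_le_multiplicity not_less_eq_eq order_refl not_prime_unit neq0_conv)
  qed
  have fin_cosets: "finite (rcosets P)"
    using lagr ord by (metis card.infinite mult_0 neq0_conv)
  interpret QA: group_action "G\<lparr>carrier := Q\<rparr>" "rcosets P" "\<lambda>g. \<lambda>C\<in>rcosets P. C #> inv g"
    using group_action.induced_action[OF action_on_rcosets[OF P_sub] Q] .
  obtain C where C: "C \<in> rcosets P" and fix_C: "\<And>q. q \<in> Q \<Longrightarrow> C #> inv q = C"
    using QA.p_group_fixed_point[OF p _ fin_cosets ndvd, of k] card_Q by (auto simp: order_def)
  obtain g where g: "g \<in> carrier G" and Cg: "C = P #> g"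
    using C by (auto simp: RCOSETS_def)
  have "g \<otimes> q \<otimes> inv g \<in> P" if "q \<in> Q" for q
  proof -
    have q: "q \<in> carrier G" "inv q \<in> Q"
      using that Q by (auto intro: subgroup.mem_carrier subgroup.m_inv_closed)
    have PG: "P \<subseteq> carrier G"
      using P_sub by (rule subgroup.subset)
    have "P #> g #> q = P #> g"
      using fix_C[OF q(2)] q Cg by simp
    then have "P #> (g \<otimes> q \<otimes> inv g) = P"
      using g q PG by (metis coset_mult_assoc inv_closed m_closed coset_mult_one r_inv)
    then show ?thesis
      using g q by (intro coset_join1[OF _ _ P_sub]) simp_all
  qed
  with g that show thesis by blast
qed

text \<open>A conjugate of the image of \<open>M\<close> lies in \<open>P\<close> and, having the same order, equals \<open>P\<close>.\<close>

lemma iso_sylow_subgroup_if_embedded: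
  assumes "group G" and P: "sylow_subgroup p P G" and "group M"
    and h: "h \<in> hom M G" "inj_on h (carrier M)"
    and card_M: "card (carrier M) = p ^ multiplicity p (order G)"
  shows "M \<cong> G\<lparr>carrier := P\<rparr>"
proof -
  interpret G: group G by fact
  interpret h: group_hom M G h
    using assms by (simp add: group_hom_def group_hom_axioms_def)
  let ?Q = "h ` carrier M"
  have card_Q: "card ?Q = p ^ multiplicity p (order G)"
    using h(2) card_M by (simp add: card_image)
  obtain g where g: "g \<in> carrier G" and conj: "\<And>q. q \<in> ?Q \<Longrightarrow> g \<otimes>\<^bsub>G\<^esub> q \<otimes>\<^bsub>G\<^esub> inv\<^bsub>G\<^esub> g \<in> P"
    using G.p_subgroup_conjugate_into_sylow[OF P h.img_is_subgroup card_Q] by blast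
  define f where "f = (\<lambda>x. g \<otimes>\<^bsub>G\<^esub> h x \<otimes>\<^bsub>G\<^esub> inv\<^bsub>G\<^esub> g)"
  have f_inj: "inj_on f (carrier M)"
    using h g by (auto simp: inj_on_def f_def)
  have f_P: "f ` carrier M \<subseteq> P"
    using conj by (auto simp: f_def)
  have "card P = card (f ` carrier M)" "finite P"
    using P card_M f_inj
    by (auto simp: sylow_subgroup_def card_image dest: subgroup.subset finite_subset)
  then have "f ` carrier M = P"
    using f_P by (simp add: card_subset_eq)
  then have "bij_betw f (carrier M) P"
    using f_inj by (simp add: bij_betw_def)
  moreover have "f (x \<otimes>\<^bsub>M\<^esub> y) = f x \<otimes>\<^bsub>G\<^esub> f y" if "x \<in> carrier M" "y \<in> carrier M" for x y
    using that g by (simp add: f_def G.m_assoc G.inv_solve_left)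
  ultimately have "f \<in> iso M (G\<lparr>carrier := P\<rparr>)"
    by (auto simp: bij_betw_def intro!: isoI homI)
  then show ?thesis
    by (rule is_isoI)
qed

section \<open>Twists of the forest of blocks\<close>

locale block_forest =
  fixes p n :: nat
  assumes p_ge_2: "2 \<le> p"
begin

text \<open>The pair \<open>(k, y)\<close> is the block \<open>{y * p ^ k..<Suc y * p ^ k}\<close> of points counted from \<open>0\<close>, and the
  condition says that it ends by \<open>n\<close>. The parent of \<open>(k, y)\<close> is \<open>(Suc k, y div p)\<close> if this is a
  block, and its position among the children of the parent is \<open>y mod p\<close>.\<close>

definition blocks :: "(nat \<times> nat) set"
  where "blocks = {(k, y). Suc y * p ^ k \<le> n}"

lemma mem_blocks: "(k, y) \<in> blocks \<longleftrightarrow> Suc y * p ^ k \<le> n"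
  by (simp add: blocks_def)

lemma level_less:
  assumes "(k, y) \<in> blocks" shows "k < n"
proof -
  have "k < 2 ^ k" by simp
  also have "\<dots> \<le> p ^ k" using p_ge_2 by (simp add: power_mono)
  also have "\<dots> \<le> Suc y * p ^ k" by simp
  also have "\<dots> \<le> n" using assms by (simp add: mem_blocks)
  finally show ?thesis .
qed

lemma finite_blocks: "finite blocks"
proof (rule finite_subset)
  show "blocks \<subseteq> {..<n} \<times> {..<n}"
  proof clarify
    fix k y assume *: "(k, y) \<in> blocks"
    have "Suc y * 1 \<le> Suc y * p ^ k"
      using p_ge_2 by (intro mult_left_mono) auto
    with * level_less[OF *] show "k \<in> {..<n} \<and> y \<in> {..<n}"
      by (simp add: mem_blocks)
  qed
qed simp

lemma parent_in_blocks:
  assumes "(Suc k, y div p) \<in> blocks"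
  shows "(k, y) \<in> blocks"
proof -
  have "y < p * Suc (y div p)"
    using p_ge_2 by (simp add: dividend_less_times_div)
  then have "Suc y * p ^ k \<le> p * Suc (y div p) * p ^ k"
    by (intro mult_right_mono) auto
  with assms show ?thesis
    by (simp add: mem_blocks algebra_simps)
qed

text \<open>The index, within its level, of the image of a block: the parent is moved first, and then the
  position among its children is shifted by the value of \<open>c\<close> at the \<^emph>\<open>image\<close> of the parent.
  The recursion ends at the roots, since the levels are bounded by \<open>n\<close>.\<close>

function twist_index :: "(nat \<times> nat \<Rightarrow> int) \<Rightarrow> nat \<Rightarrow> nat \<Rightarrow> nat" where
  "twist_index c k y =
    (if (Suc k, y div p) \<in> blocks
     then let z = twist_index c (Suc k) (y div p)
          in p * z + nat ((int y + c (Suc k, z)) mod int p)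
     else y)"
  by pat_completeness auto
termination
proof (relation "measure (\<lambda>(c, k, y). n - k)")
  fix c k y assume "(Suc k, y div p) \<in> blocks"
  from level_less[OF this] show "((c, Suc k, y div p), (c, k, y)) \<in> measure (\<lambda>(c, k, y). n - k)"
    by simp
qed simp

declare twist_index.simps [simp del]

lemma twist_index_root: "(Suc k, y div p) \<notin> blocks \<Longrightarrow> twist_index c k y = y"
  by (simp add: twist_index.simps)

lemma
  assumes "(Suc k, y div p) \<in> blocks"
  shows twist_index_div: "twist_index c k y div p = twist_index c (Suc k) (y div p)"
    and twist_index_mod: "int (twist_index c k y mod p) =
      (int y + c (Suc k, twist_index c (Suc k) (y div p))) mod int p"
proof -
  define z r where "z = twist_index c (Suc k) (y div p)"
    and "r = (int y + c (Suc k, z)) mod int p"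
  have r: "0 \<le> r" "r < int p"
    using p_ge_2 by (simp_all add: r_def)
  have "twist_index c k y = p * z + nat r"
    using assms by (subst twist_index.simps) (simp add: Let_def z_def r_def)
  moreover have "nat r < p"
    using r by linarith
  ultimately have "twist_index c k y div p = z" and *: "twist_index c k y mod p = nat r"
    by simp_all
  then show "twist_index c k y div p = twist_index c (Suc k) (y div p)"
    by (simp only: z_def)
  show "int (twist_index c k y mod p) = (int y + c (Suc k, twist_index c (Suc k) (y div p))) mod int p"
    unfolding * using r(1) by (simp only: int_nat_eq if_True r_def z_def)
qed

lemma eqI_div_mod:
  assumes "x div p = y div p" "int (x mod p) = int (y mod p)"
  shows "x = y"
proof -
  have "x mod p = y mod p"
    using assms(2) by (rule of_nat_eq_iff[THEN iffD1])
  with assms(1) have "x div p * p + x mod p = y div p * p + y mod p"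
    by simp
  then show ?thesis
    by (simp only: div_mult_mod_eq)
qed

text \<open>Induction from the roots down to the leaves.\<close>

lemma block_induct [consumes 0, case_names root child]:
  assumes "\<And>k y. (Suc k, y div p) \<notin> blocks \<Longrightarrow> Q k y"
    and "\<And>k y. (Suc k, y div p) \<in> blocks \<Longrightarrow> Q (Suc k) (y div p) \<Longrightarrow> Q k y"
  shows "Q k y"
proof (induction rule: twist_index.induct[of "\<lambda>_ k y. Q k y"])
  case (1 c k y)
  show ?case
  proof (cases "(Suc k, y div p) \<in> blocks")
    case True
    from assms(2)[OF True "1.IH"[OF True]] show ?thesis .
  qed (rule assms(1))
qed

lemma twist_index_in_blocks: "(k, y) \<in> blocks \<Longrightarrow> (k, twist_index c k y) \<in> blocks"
proof (induction k y rule: block_induct)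
  case (child k y)
  then show ?case
    by (metis parent_in_blocks twist_index_div)
qed (simp add: twist_index_root)

lemma twist_index_parent_in_blocks:
  "(Suc k, twist_index c k y div p) \<in> blocks \<longleftrightarrow> (Suc k, y div p) \<in> blocks"
  by (cases "(Suc k, y div p) \<in> blocks")
    (simp_all add: twist_index_div twist_index_in_blocks twist_index_root)

lemma twist_index_inject: "twist_index c k y = twist_index c k y' \<Longrightarrow> y = y'"
proof (induction k y arbitrary: y' rule: block_induct)
  case (root k y)
  then show ?case
    by (metis twist_index_parent_in_blocks twist_index_root)
next
  case (child k y)
  have y': "(Suc k, y' div p) \<in> blocks"
    using child.hyps child.prems by (metis twist_index_parent_in_blocks)
  have d: "y div p = y' div p"
    using child.prems twist_index_div[OF child.hyps, of c] twist_index_div[OF y', of c] by (intro child.IH) simp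
  have "(int y + c (Suc k, twist_index c (Suc k) (y div p))) mod int p
      = (int y' + c (Suc k, twist_index c (Suc k) (y div p))) mod int p"
    using child.prems twist_index_mod[OF child.hyps, of c] twist_index_mod[OF y', of c] d by simp
  then have "int y mod int p = int y' mod int p"
    by (simp add: mod_eq_dvd_iff)
  then have "int (y mod p) = int (y' mod p)"
    by (simp only: zmod_int)
  with d show ?case
    by (rule eqI_div_mod)
qed

definition twist :: "(nat \<times> nat \<Rightarrow> int) \<Rightarrow> nat \<times> nat \<Rightarrow> nat \<times> nat"
  where "twist c = (\<lambda>(k, y). (k, twist_index c k y))"

lemma twist_permutes: "twist c permutes blocks"
proof (rule bij_imp_permutes)
  have inj: "inj_on (twist c) blocks"
    by (auto simp: inj_on_def twist_def dest: twist_index_inject)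
  have "twist c ` blocks \<subseteq> blocks"
    by (auto simp: twist_def twist_index_in_blocks)
  with inj show "bij_betw (twist c) blocks blocks"
    by (simp add: bij_betw_def endo_inj_surj finite_blocks)
  show "twist c x = x" if "x \<notin> blocks" for x
  proof (cases x)
    case (Pair k y)
    then have "(Suc k, y div p) \<notin> blocks"
      using that parent_in_blocks by blast
    then show ?thesis
      by (simp add: Pair twist_def twist_index_root)
  qed
qed

lemma twist_index_cong:
  assumes "\<And>k y. (Suc k, y) \<in> blocks \<Longrightarrow> c (Suc k, y) mod int p = d (Suc k, y) mod int p"
  shows "twist_index c k y = twist_index d k y"
proof (induction k y rule: block_induct)
  case (child k y)
  have "c (Suc k, twist_index d (Suc k) (y div p)) mod int p = d (Suc k, twist_index d (Suc k) (y div p)) mod int p"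
    by (rule assms[OF twist_index_in_blocks[OF child.hyps]])
  then have "int (twist_index c k y mod p) = int (twist_index d k y mod p)"
    unfolding twist_index_mod[OF child.hyps] child.IH by (rule mod_add_cong[OF refl])
  moreover have "twist_index c k y div p = twist_index d k y div p"
    by (simp only: twist_index_div[OF child.hyps] child.IH)
  ultimately show ?case
    by (rule eqI_div_mod[rotated])
qed (simp add: twist_index_root)

text \<open>Write \<open>u\<close> for the image of the parent under the first twist and \<open>v\<close> for the image of \<open>u\<close>
  under the second one. The two shifts add up to \<open>b u + a v\<close>, and \<open>u = inv (twist a) v\<close>, so this
  is a single shift by a function of \<open>v\<close>.\<close>

lemma twist_index_comp:
  "twist_index (\<lambda>x. a x + b (inv' (twist a) x)) k y = twist_index a k (twist_index b k y)"
proof (induction k y rule: block_induct)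
  case (child k y)
  define u where "u = twist_index b (Suc k) (y div p)"
  define v where "v = twist_index a (Suc k) u"
  have tb: "(Suc k, twist_index b k y div p) \<in> blocks"
    using child.hyps by (simp add: twist_index_parent_in_blocks)
  have "inv' (twist a) (Suc k, v) = (Suc k, u)"
    using permutes_inverses(2)[OF twist_permutes, of a "(Suc k, u)"] by (simp add: twist_def v_def)
  then have "int (twist_index (\<lambda>x. a x + b (inv' (twist a) x)) k y mod p)
      = (int y + (a (Suc k, v) + b (Suc k, u))) mod int p"
    unfolding twist_index_mod[OF child.hyps] child.IH by (simp only: u_def v_def)
  also have "\<dots> = ((int y + b (Suc k, u)) mod int p + a (Suc k, v)) mod int p"
    by (subst mod_add_left_eq) (simp only: ac_simps)
  also have "\<dots> = (int (twist_index b k y mod p) + a (Suc k, v)) mod int p"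
    unfolding twist_index_mod[OF child.hyps] u_def ..
  also have "\<dots> = int (twist_index a k (twist_index b k y) mod p)"
    unfolding twist_index_mod[OF tb] twist_index_div[OF child.hyps] u_def v_def
    by (simp only: zmod_int mod_add_left_eq)
  finally have "int (twist_index (\<lambda>x. a x + b (inv' (twist a) x)) k y mod p)
    = int (twist_index a k (twist_index b k y) mod p)" .
  moreover have "twist_index (\<lambda>x. a x + b (inv' (twist a) x)) k y div p = twist_index a k (twist_index b k y) div p"
    by (simp only: twist_index_div[OF child.hyps] twist_index_div[OF tb] child.IH)
  ultimately show ?case
    by (rule eqI_div_mod[rotated])
qed (simp add: twist_index_root)

lemma twist_cocycle: "twist (\<lambda>x. a x + b (inv' (twist a) x)) = twist a \<circ> twist b"
  using twist_index_comp by (auto simp: twist_def fun_eq_iff)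

text \<open>Every block \<open>w\<close> of positive level is the image of some block \<open>z\<close>, and comparing the images of the
  first child of \<open>z\<close> recovers \<open>c w\<close> modulo \<open>p\<close>.\<close>

lemma twist_eqD:
  assumes eq: "twist c = twist d" and B: "(Suc k, y) \<in> blocks"
  shows "c (Suc k, y) mod int p = d (Suc k, y) mod int p"
proof -
  have "bij_betw (twist c) blocks blocks"
    using twist_permutes permutes_imp_bij by blast
  then obtain x where x: "x \<in> blocks" "twist c x = (Suc k, y)"
    using B by (metis bij_betw_imp_surj_on imageE)
  then obtain z where z: "(Suc k, z) \<in> blocks" "twist_index c (Suc k) z = y"
    by (cases x) (auto simp: twist_def)
  have eq': "twist_index c l w = twist_index d l w" for l w
    using fun_cong[OF eq, of "(l, w)"] by (simp add: twist_def)
  have pz: "p * z div p = z"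
    using p_ge_2 by simp
  have "(int (p * z) + c (Suc k, y)) mod int p = (int (p * z) + d (Suc k, y)) mod int p"
    using twist_index_mod[of k "p * z" c] twist_index_mod[of k "p * z" d] z unfolding pz eq' by simp
  then show ?thesis
    by (simp add: mod_eq_dvd_iff)
qed

text \<open>By induction upwards: the image of a block is the parent of the image of its first child.\<close>

lemma twist_eqI_leaves:
  assumes eq: "\<And>y. (0, y) \<in> blocks \<Longrightarrow> twist_index c 0 y = twist_index d 0 y"
  shows "twist c = twist d"
proof -
  have "twist_index c k y = twist_index d k y" if "(k, y) \<in> blocks" for k y
    using that
  proof (induction k arbitrary: y)
    case (Suc k)
    have pz: "p * y div p = y"
      using p_ge_2 by simp
    have "twist_index c k (p * y) = twist_index d k (p * y)"
      by (rule Suc.IH, rule parent_in_blocks) (simp only: pz Suc.prems)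
    then show ?case
      using twist_index_div[of k "p * y" c] twist_index_div[of k "p * y" d] Suc.prems pz by simp
  qed (use eq in blast)
  moreover have "twist_index c k y = twist_index d k y" if "(k, y) \<notin> blocks" for k y
    using that twist_index_root[of k y] parent_in_blocks[of k y] by metis
  ultimately show ?thesis
    unfolding twist_def by fastforce
qed

definition inner_blocks :: "(nat \<times> nat) set"
  where "inner_blocks = {(k, y) \<in> blocks. 0 < k}"

text \<open>Choosing residues in \<open>{0..<p}\<close> on the blocks of positive level selects one function \<open>c\<close> for
  each twist.\<close>

lemma card_range_twist: "card (range twist) = p ^ card inner_blocks"
proof -
  let ?F = "inner_blocks \<rightarrow>\<^sub>E {0..<int p}"
  have "bij_betw twist ?F (range twist)"
  proof (rule bij_betw_imageI)
    show "inj_on twist ?F"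
    proof (rule inj_onI)
      fix c d assume c: "c \<in> ?F" and d: "d \<in> ?F" and eq: "twist c = twist d"
      show "c = d"
      proof (rule PiE_ext[OF c d])
        fix x assume x: "x \<in> inner_blocks"
        then obtain k y where xk: "x = (Suc k, y)" "(Suc k, y) \<in> blocks"
          by (cases x; cases "fst x") (auto simp: inner_blocks_def)
        have "c x mod int p = d x mod int p"
          using twist_eqD[OF eq] xk by simp
        moreover have "0 \<le> c x" "c x < int p" "0 \<le> d x" "d x < int p"
          using PiE_mem[OF c x] PiE_mem[OF d x] by simp_all
        ultimately show "c x = d x"
          by simp
      qed
    qed
    show "twist ` ?F = range twist"
    proof (intro equalityI subsetI)
      fix f assume "f \<in> range twist"
      then obtain c where f: "f = twist c" by blast
      define d where "d = (\<lambda>x\<in>inner_blocks. c x mod int p)"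
      have "twist_index c k y = twist_index d k y" for k y
        by (intro twist_index_cong) (simp add: d_def inner_blocks_def)
      then have "f = twist d"
        by (simp add: f twist_def)
      moreover have "d \<in> ?F"
        using p_ge_2 by (auto simp: d_def)
      ultimately show "f \<in> twist ` ?F" by blast
    qed auto
  qed
  then have "card (range twist) = card ?F"
    using bij_betw_same_card by metis
  also have "finite inner_blocks"
    by (rule finite_subset[OF _ finite_blocks]) (auto simp: inner_blocks_def)
  then have "card ?F = p ^ card inner_blocks"
    by (simp add: card_funcsetE)
  finally show ?thesis .
qed

end

section \<open>Legendre's formula\<close>

text \<open>Adding the point \<open>Suc n\<close> completes a new block of level \<open>k\<close> exactly when \<open>p ^ k\<close> divides
  \<open>Suc n\<close>, so the number of new blocks of positive level is the exponent of \<open>p\<close> in \<open>Suc n\<close>.\<close>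

lemma legendre_block_count:
  fixes p n :: nat
  assumes "prime p"
  shows "card (block_forest.inner_blocks p n) = multiplicity p (fact n)"
proof -
  interpret p: block_forest p m for m
    by unfold_locales (use assms prime_ge_2_nat in blast)
  show "card (p.inner_blocks n) = multiplicity p (fact n)"
  proof (induction n)
    case 0
    have "p.inner_blocks 0 = {}"
      using assms by (auto simp: p.inner_blocks_def p.mem_blocks prime_gt_0_nat)
    then show ?case by simp
  next
    case (Suc n)
    let ?v = "multiplicity p (Suc n)"
    \<comment> \<open>The blocks that end exactly at \<open>Suc n\<close>: one for each \<open>k\<close> with \<open>p ^ k\<close> dividing \<open>Suc n\<close>.\<close>
    define new where "new = (\<lambda>k. (k, Suc n div p ^ k - 1)) ` {1..?v}"
    have pk: "p ^ k dvd Suc n \<longleftrightarrow> k \<le> ?v" for k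
      using assms by (intro power_dvd_iff_le_multiplicity) auto
    have "Suc y * p ^ k = Suc n \<longleftrightarrow> k \<le> ?v \<and> y = Suc n div p ^ k - 1" for k y
    proof -
      have "Suc y * p ^ k = Suc n \<longleftrightarrow> p ^ k dvd Suc n \<and> Suc y = Suc n div p ^ k"
        using assms prime_gt_0_nat[of p]
        by (metis dvd_div_mult_self dvd_triv_right nonzero_mult_div_cancel_right power_not_zero not_gr0)
      moreover have "p ^ k dvd Suc n \<Longrightarrow> Suc n div p ^ k > 0"
        by (metis dvd_div_eq_0_iff neq0_conv nat.distinct(1))
      ultimately show ?thesis
        unfolding pk by auto
    qed
    then have "new = {(k, y). 0 < k \<and> Suc y * p ^ k = Suc n}"
      by (auto simp: new_def)
    then have "p.inner_blocks (Suc n) = p.inner_blocks n \<union> new" "p.inner_blocks n \<inter> new = {}"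
      by (auto simp: p.inner_blocks_def p.blocks_def le_Suc_eq simp del: mult_Suc)
    moreover have "finite (p.inner_blocks n)"
      by (rule finite_subset[OF _ p.finite_blocks]) (auto simp: p.inner_blocks_def)
    moreover have "finite new" "card new = ?v"
      by (auto simp: new_def card_image inj_on_def)
    ultimately have "card (p.inner_blocks (Suc n)) = card (p.inner_blocks n) + ?v"
      by (simp add: card_Un_disjoint)
    also have "\<dots> = multiplicity p (fact (Suc n))"
      using assms Suc by (simp add: prime_elem_multiplicity_mult_distrib del: mult_Suc)
    finally show ?case .
  qed
qed

section \<open>The Sylow subgroup of twists\<close>

context block_forest
begin

lemma leaf_in_blocks: "(0, y) \<in> blocks \<longleftrightarrow> y < n"
  by (simp add: mem_blocks Suc_le_eq)

lemma permutation_cocycle_twist: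
  assumes "0 < n"
  shows "permutation_cocycle blocks twist"
proof
  show "blocks \<noteq> {}"
    using assms leaf_in_blocks by blast
  show "twist c = twist d" if "\<And>x. x \<in> blocks \<Longrightarrow> c x = d x" for c d
  proof -
    have "twist_index c k y = twist_index d k y" for k y
      by (rule twist_index_cong) (simp add: that)
    then show ?thesis
      by (simp add: twist_def)
  qed
qed (fact finite_blocks twist_permutes twist_cocycle)+

text \<open>The action on the leaves \<open>(0, y)\<close>, renumbered from \<open>{0..<n}\<close> to \<open>{1..n}\<close>.\<close>

definition on_points :: "(nat \<times> nat \<Rightarrow> nat \<times> nat) \<Rightarrow> nat \<Rightarrow> nat"
  where "on_points f = (\<lambda>i. if i \<in> {1..n} then Suc (snd (f (0, i - 1))) else i)"

lemma on_points_Suc: "y < n \<Longrightarrow> on_points (twist c) (Suc y) = Suc (twist_index c 0 y)"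
  by (simp add: on_points_def twist_def)

lemma twist_index_0_less: "y < n \<Longrightarrow> twist_index c 0 y < n"
  using twist_index_in_blocks[of 0 y c] by (simp add: leaf_in_blocks)

lemma on_points_permutes: "on_points (twist c) permutes {1..n}"
proof (rule bij_imp_permutes)
  have "on_points (twist c) i \<in> {1..n}" if i: "i \<in> {1..n}" for i
  proof -
    obtain y where "i = Suc y" "y < n"
      using i by (cases i) auto
    then show ?thesis
      using twist_index_0_less[of y c] by (simp add: on_points_Suc)
  qed
  moreover have "inj_on (on_points (twist c)) {1..n}"
  proof (rule inj_onI)
    fix i j assume "i \<in> {1..n}" "j \<in> {1..n}" and eq: "on_points (twist c) i = on_points (twist c) j"
    then obtain y z where y: "i = Suc y" "y < n" and z: "j = Suc z" "z < n"
      by (cases i; cases j) auto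
    then show "i = j"
      using eq twist_index_inject[of c 0 y z] by (simp add: on_points_Suc)
  qed
  ultimately show "bij_betw (on_points (twist c)) {1..n} {1..n}"
    by (intro bij_betw_imageI endo_inj_surj) auto
qed (auto simp: on_points_def)

lemma on_points_comp:
  "on_points (twist a \<circ> twist b) = on_points (twist a) \<circ> on_points (twist b)"
proof
  fix i
  show "on_points (twist a \<circ> twist b) i = (on_points (twist a) \<circ> on_points (twist b)) i"
  proof (cases "i \<in> {1..n}")
    case True
    then obtain y where y: "i = Suc y" "y < n"
      by (cases i) auto
    have "on_points (twist a \<circ> twist b) i = Suc (twist_index a 0 (twist_index b 0 y))"
      using y by (simp add: on_points_def twist_def)
    then show ?thesis
      using y by (simp add: on_points_Suc twist_index_0_less)
  qed (auto simp: on_points_def)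
qed

lemma inj_on_points: "inj_on on_points (range twist)"
proof (rule inj_onI, elim rangeE, hypsubst)
  fix c d assume eq: "on_points (twist c) = on_points (twist d)"
  show "twist c = twist d"
  proof (rule twist_eqI_leaves)
    fix y assume "(0, y) \<in> blocks"
    then have "y < n"
      by (simp add: leaf_in_blocks)
    then show "twist_index c 0 y = twist_index d 0 y"
      using fun_cong[OF eq, of "Suc y"] by (simp add: on_points_Suc)
  qed
qed

end

theorem corollary3p6:
  fixes n p :: nat and P :: "(nat \<Rightarrow> nat) set"
  assumes "n > 0"
    and "sylow_subgroup p P (sym_group n)"
  shows "IYB_group ((sym_group n)\<lparr>carrier := P\<rparr>)"
proof -
  have p: "prime p" and P: "subgroup P (sym_group n)"
    using assms(2) by (simp_all add: sylow_subgroup_def)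
  interpret block_forest p n
    by unfold_locales (rule prime_ge_2_nat[OF p])
  interpret permutation_cocycle blocks twist
    by (rule permutation_cocycle_twist[OF assms(1)])
  have "image_group \<cong> (sym_group n)\<lparr>carrier := P\<rparr>"
  proof (rule iso_sylow_subgroup_if_embedded[OF sym_group_is_group assms(2) group_image_group])
    show "on_points \<in> hom image_group (sym_group n)"
      by (rule homI)
        (auto simp: image_group_def sym_group_carrier sym_group_mult on_points_comp
          simp del: One_nat_def intro: on_points_permutes)
    show "inj_on on_points (carrier image_group)"
      using inj_on_points by (simp add: image_group_def)
    have "order (sym_group n) = fact n"
      using card_permutations[OF refl, of "{1..n}"] by (simp add: order_def sym_group_def)
    then show "card (carrier image_group) = p ^ multiplicity p (order (sym_group n))"
      by (simp add: image_group_def card_range_twist legendre_block_count[OF p])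
  qed
  then show ?thesis
    by (rule IYB_group_if_iso_image_group[OF group.subgroup_imp_group[OF sym_group_is_group P]])
qed

end
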